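(* Let $(\mathcal{H}_h,(\cdot,\cdot))$ be a finite-dimensional real inner product space with identity operator $\mathcal{I}_h$, and let $\mathcal{A}_h:\mathcal{H}_h\to\mathcal{H}_h$ be a linear operator such that $a(v_h,w_h):=(\mathcal{A}_hv_h,w_h)$ is a symmetric bilinear form with $a(v_h,v_h)\ge a_0(v_h,v_h)$ for all $v_h\in\mathcal{H}_h$, for some constant $a_0>0$. Let $f_h\in\mathcal{H}_h$, let $n,m\ge 1$ be integers, let $c_1,\dots,c_n\in\mathbb{R}$ and $t_1,\dots,t_n>0$, and let $s,d\ge 0$ be constants with $s\neq d$ and $s\notin\{t_i\}_{1\le i\le n}$. Put $\mathcal{A}_h^i=\mathcal{A}_h+t_i\mathcal{I}_h$, $u_h(t_i)=(\mathcal{A}_h+t_i\mathcal{I}_h)^{-1}f_h$ and $u_h=\sum_{i=1}^n c_i(\mathcal{A}_h+t_i\mathcal{I}_h)^{-1}f_h$. Let $u_h^{\mathrm{rbm}}$ be the output of the algorithm RCGBM$(s,d,m)$ (defined in the context) with the preconditioner $\mathcal{B}_h=(\mathcal{A}_h+s\mathcal{I}_h)^{-1}$. Then $$\|u_h-u_h^{\mathrm{rbm}}\|_{\mathcal{A}_h}\le 2\sum_{i=1}^n|c_i|\left(\frac{\sqrt{\kappa(\mathcal{B}_h\mathcal{A}_h^i)}-1}{\sqrt{\kappa(\mathcal{B}_h\mathcal{A}_h^i)}+1}\right)^m\|u_h(t_i)\|_{\mathcal{A}_h^i}.$$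
   Context: Norms and condition number: for a symmetric positive definite operator $\mathcal{C}$ on $(\mathcal{H}_h,(\cdot,\cdot))$, $\|v_h\|_{\mathcal{C}}:=\sqrt{(\mathcal{C}v_h,v_h)}$. For symmetric positive definite $\mathcal{B},\mathcal{C}$, $\kappa(\mathcal{B}\mathcal{C})=\lambda_{\max}(\mathcal{B}\mathcal{C})/\lambda_{\min}(\mathcal{B}\mathcal{C})$ is the spectral condition number (the eigenvalues of $\mathcal{B}\mathcal{C}$ are real and positive). Algorithm RCGBM$(s,d,m)$ (Reduced Conjugate Gradient Basis Method), with inputs $\mathcal{H}_h$, $\mathcal{A}_h$, $f_h$, $c_i$, $t_i$ $(1\le i\le n)$, distinct constants $s,d\ge0$, an integer $m\ge1$, and a preconditioner $\mathcal{B}_h:\mathcal{H}_h\to\mathcal{H}_h$ for $\mathcal{A}_h+s\mathcal{I}_h$. Write $\mathcal{A}_d=\mathcal{A}_h+d\mathcal{I}_h$. 1. Initialize $u_0=0$, $r_0=f_h$, $p_0=z_0=\mathcal{B}_hr_0$. 2. For $k=1,\dots,m-1$ compute $\alpha_k=(r_{k-1},z_{k-1})/(\mathcal{A}_dp_{k-1},p_{k-1})$; $u_k=u_{k-1}+\alpha_kp_{k-1}$; $r_k=r_{k-1}-\alpha_k\mathcal{A}_dp_{k-1}$; $z_k=\mathcal{B}_hr_k$; $\beta_k=(r_k,z_k)/(r_{k-1},z_{k-1})$; $p_k=z_k+\beta_kp_{k-1}$. (This is the preconditioned conjugate gradient iteration for $\mathcal{A}_du=f_h$ with preconditioner $\mathcal{B}_h$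 and zero initial guess. If some residual $r_{k}$ vanishes, the iteration stops and all subsequent directions are taken to be $0$.) 3. Set $\mathcal{H}_h^m=\mathrm{span}\{p_0,\dots,p_{m-1}\}$. 4. For $i=1,\dots,n$ let $u_h^{\mathrm{rbm}}(t_i)\in\mathcal{H}_h^m$ be the unique element satisfying $a(u_h^{\mathrm{rbm}}(t_i),v_h)+t_i(u_h^{\mathrm{rbm}}(t_i),v_h)=(f_h,v_h)$ for all $v_h\in\mathcal{H}_h^m$. 5. Output $u_h^{\mathrm{rbm}}=\sum_{i=1}^nc_iu_h^{\mathrm{rbm}}(t_i)$. *)

theory Defs
  imports "HOL-Analysis.Analysis"
begin

definition shifted :: "('a::real_vector \<Rightarrow> 'a) \<Rightarrow> real \<Rightarrow> 'a \<Rightarrow> 'a" where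
  "shifted A t = (\<lambda>v. A v + t *\<^sub>R v)"

definition energy_norm :: "('a::real_inner \<Rightarrow> 'a) \<Rightarrow> 'a \<Rightarrow> real" where
  "energy_norm C v = sqrt (C v \<bullet> v)"

definition eigenvalues :: "('a::real_vector \<Rightarrow> 'a) \<Rightarrow> real set" where
  "eigenvalues T = {l. \<exists>v. v \<noteq> 0 \<and> T v = l *\<^sub>R v}"

text \<open>
  Only real eigenvalues are considered, so this is the spectral condition number for
  operators \<open>T\<close> with real positive spectrum, such as a product of two symmetric positive
  definite operators. On a space of positive finite dimension the set of eigenvalues of
  such a \<open>T\<close> is finite and nonempty.
\<close>
definition spectral_cond :: "('a::euclidean_space \<Rightarrow> 'a) \<Rightarrow> real" where
  "spectral_cond T = Max (eigenvalues T) / Min (eigenvalues T)"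

text \<open>
  One step of the preconditioned conjugate gradient iteration for \<open>D u = f\<close> with
  preconditioner \<open>B\<close>, on the state \<open>(u, r, z, p)\<close> of iterate, residual, preconditioned
  residual and direction. Once the residual vanishes the iteration has stopped and all
  further directions are \<open>0\<close>.
\<close>
fun pcg_step :: "('a::real_inner \<Rightarrow> 'a) \<Rightarrow> ('a \<Rightarrow> 'a) \<Rightarrow> 'a \<times> 'a \<times> 'a \<times> 'a \<Rightarrow> 'a \<times> 'a \<times> 'a \<times> 'a"
where
  "pcg_step D B (u, r, z, p) =
    (if r = 0 then (u, r, z, 0)
     else
       (let \<alpha> = (r \<bullet> z) / (D p \<bullet> p);
            u' = u + \<alpha> *\<^sub>R p;
            r' = r - \<alpha> *\<^sub>R D p;
            z' = B r';
            \<beta> = (r' \<bullet> z') / (r \<bullet> z);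
            p' = (if r' = 0 then 0 else z' + \<beta> *\<^sub>R p)
        in (u', r', z', p')))"

primrec pcg :: "('a::real_inner \<Rightarrow> 'a) \<Rightarrow> ('a \<Rightarrow> 'a) \<Rightarrow> 'a \<Rightarrow> nat \<Rightarrow> 'a \<times> 'a \<times> 'a \<times> 'a" where
  "pcg D B f 0 = (0, f, B f, B f)"
| "pcg D B f (Suc k) = pcg_step D B (pcg D B f k)"

definition pcg_dir :: "('a::real_inner \<Rightarrow> 'a) \<Rightarrow> ('a \<Rightarrow> 'a) \<Rightarrow> 'a \<Rightarrow> nat \<Rightarrow> 'a" where
  "pcg_dir D B f k = (case pcg D B f k of (u, r, z, p) \<Rightarrow> p)"

definition galerkin :: "('a::real_inner \<Rightarrow> 'a) \<Rightarrow> 'a set \<Rightarrow> 'a \<Rightarrow> real \<Rightarrow> 'a" where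
  "galerkin A V f t = (THE u. u \<in> V \<and> (\<forall>v\<in>V. A u \<bullet> v + t * (u \<bullet> v) = f \<bullet> v))"

text \<open>
  The output of RCGBM\<open>(s, d, m)\<close>. The parameter \<open>s\<close> enters the algorithm only through the
  preconditioner \<open>B\<close>, an approximate inverse of \<open>shifted A s\<close>.
\<close>
definition rcgbm ::
  "('a::real_inner \<Rightarrow> 'a) \<Rightarrow> 'a \<Rightarrow> nat \<Rightarrow> (nat \<Rightarrow> real) \<Rightarrow> (nat \<Rightarrow> real) \<Rightarrow> ('a \<Rightarrow> 'a) \<Rightarrow> real \<Rightarrow> nat \<Rightarrow> 'a"
where
  "rcgbm A f n c t B d m =
    (let V = span (pcg_dir (shifted A d) B f ` {0..<m})
     in \<Sum>i=1..n. c i *\<^sub>R galerkin A V f (t i))"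

end

theory Submission
  imports Defs
begin

text \<open>
  Write \<open>A\<^sub>t\<close> for \<open>shifted A t\<close>, let \<open>B\<close> be the inverse of \<open>A\<^sub>s\<close>, and let \<open>V\<^sub>k\<close> be the span of
  the first \<open>k\<close> search directions of the preconditioned conjugate gradient iteration for
  \<open>A\<^sub>d\<close>. The iteration is run for the single shift \<open>d\<close>, yet its search space serves every
  shift \<open>t\<close> equally well: \<open>B A\<^sub>t = I + (t - s) B\<close>, so all the operators \<open>B A\<^sub>t\<close> are affine
  functions of \<open>B\<close>. The recurrences of the iteration show that \<open>B A\<^sub>d\<close> maps \<open>V\<^sub>k\<close> into
  \<open>V\<^sub>k\<^sub>+\<^sub>1\<close> (\<open>preconditioned_pcg_space\<close>). As \<open>s \<noteq> d\<close>, the operator \<open>B\<close> is an affine function of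
  \<open>B A\<^sub>d\<close> and inherits this property, and with it every \<open>B A\<^sub>t\<close>.

  Fix \<open>t\<close> and put \<open>C = A\<^sub>t\<close>, \<open>T = B C\<close>, \<open>u = C\<inverse> f\<close>. Since \<open>T u = B f\<close> is the first search
  direction, \<open>u - Q(T) u\<close> lies in \<open>V\<^sub>m\<close> for each polynomial \<open>Q\<close> of degree at most \<open>m\<close> with
  \<open>Q(0) = 1\<close>. The Galerkin solution is the best approximation from \<open>V\<^sub>m\<close> in the energy norm
  of \<open>C\<close> (\<open>galerkin_best_approximation\<close>), so its error is at most the norm of \<open>Q(T) u\<close>.
  The scaled Chebyshev polynomial \<open>Q = T\<^sub>m(X) / T\<^sub>m(h)\<close>, where the affine function \<open>X\<close> of \<open>T\<close>
  maps the spectral interval of \<open>T\<close> onto \<open>[-1, 1]\<close> and \<open>0\<close> to \<open>h\<close>, gives the classical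
  factor (\<open>krylov_chebyshev_approximation\<close>).

  The estimate \<open>\<parallel>T\<^sub>m(X) u\<parallel> \<le> \<parallel>u\<parallel>\<close> is obtained without diagonalising \<open>T\<close>, from the
  Pell identity \<open>T\<^sub>m\<^sup>2 + (1 - X\<^sup>2) U\<^sub>m\<^sub>-\<^sub>1\<^sup>2 = 1\<close> read as an identity of quadratic forms
  (\<open>energy_norm_cheb_T_le\<close>). The only spectral fact required is that the Rayleigh quotient
  of \<open>T\<close> lies between the extreme eigenvalues (\<open>Rayleigh_bounds\<close>).

  Finally the energy norm of \<open>A\<close> is dominated by that of each \<open>A\<^sub>t\<close>, and the triangle
  inequality adds up the contributions of the shifts.
\<close>

section \<open>Energy norms of symmetric positive definite operators\<close>

locale spd_operator =
  fixes C :: "'a::euclidean_space \<Rightarrow> 'a"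
  assumes lin: "linear C"
    and sym: "C v \<bullet> w = C w \<bullet> v"
    and pos: "v \<noteq> 0 \<Longrightarrow> C v \<bullet> v > 0"
begin

lemmas C_simps = linear_add[OF lin] linear_diff[OF lin] linear_scale[OF lin] linear_0[OF lin]
  linear_neg[OF lin]

lemma nonneg: "C v \<bullet> v \<ge> 0"
  using pos[of v] by (cases "v = 0") auto

lemma eq_0_iff: "C v \<bullet> v = 0 \<longleftrightarrow> v = 0"
  using pos[of v] by (cases "v = 0") auto

lemma injective: "inj C"
proof (rule linear_injective_0[THEN iffD2, OF lin], intro allI impI)
  fix v assume "C v = 0"
  then show "v = 0" using eq_0_iff[of v] by simp
qed

lemma bijective: "bij C"
  using injective linear_injective_imp_surjective[OF lin] by (simp add: bij_def)

lemma apply_inv: "C (inv C v) = v"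
  using bijective by (simp add: bij_is_surj surj_f_inv_f)

lemma spd_inv: "spd_operator (inv C)"
proof (rule spd_operator.intro)
  show "linear (inv C)"
    by (rule linearI; rule injD[OF injective]) (simp_all add: apply_inv C_simps)
  show "inv C v \<bullet> w = inv C w \<bullet> v" for v w
    using sym[of "inv C v" "inv C w"] by (simp add: apply_inv inner_commute)
  show "inv C v \<bullet> v > 0" if "v \<noteq> 0" for v
    using that pos[of "inv C v"] C_simps(4) apply_inv[of v]
    by (cases "inv C v = 0") (auto simp: inner_commute)
qed

lemma energy_norm_power2: "(energy_norm C v)\<^sup>2 = C v \<bullet> v"
  by (simp add: energy_norm_def nonneg)

lemma energy_norm_nonneg: "energy_norm C v \<ge> 0"
  by (simp add: energy_norm_def nonneg)

lemma energy_norm_scaleR: "energy_norm C (a *\<^sub>R v) = \<bar>a\<bar> * energy_norm C v"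
  by (simp add: energy_norm_def C_simps real_sqrt_mult flip: mult.assoc)

lemma energy_norm_0: "energy_norm C 0 = 0"
  by (simp add: energy_norm_def)

lemma Cauchy_Schwarz: "C v \<bullet> w \<le> energy_norm C v * energy_norm C w"
proof (cases "v = 0 \<or> w = 0")
  case True
  then show ?thesis by (auto simp: energy_norm_def C_simps)
next
  case False
  define x y where "x = energy_norm C v" and "y = energy_norm C w"
  have xy: "x > 0" "y > 0"
    using False pos by (auto simp: x_def y_def energy_norm_def)
  have sq: "C v \<bullet> v = x\<^sup>2" "C w \<bullet> w = y\<^sup>2"
    by (simp_all add: x_def y_def energy_norm_power2)
  have "0 \<le> C (y *\<^sub>R v - x *\<^sub>R w) \<bullet> (y *\<^sub>R v - x *\<^sub>R w)"
    by (rule nonneg)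
  also have "\<dots> = 2 * (x * y) * (x * y - C v \<bullet> w)"
    by (simp add: C_simps inner_diff sym[of w v] sq) (simp add: power2_eq_square algebra_simps)
  finally have "x * y - C v \<bullet> w \<ge> 0"
    using xy mult_pos_pos[OF xy] zero_le_mult_iff[of "2 * (x * y)" "x * y - C v \<bullet> w"] by linarith
  then show ?thesis by (simp add: x_def y_def)
qed

lemma energy_norm_triangle: "energy_norm C (v + w) \<le> energy_norm C v + energy_norm C w"
proof (rule power2_le_imp_le)
  have "(energy_norm C (v + w))\<^sup>2 = (energy_norm C v)\<^sup>2 + 2 * (C v \<bullet> w) + (energy_norm C w)\<^sup>2"
    by (simp add: energy_norm_power2 C_simps inner_add sym[of w v])
  also have "\<dots> \<le> (energy_norm C v + energy_norm C w)\<^sup>2"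
    using Cauchy_Schwarz[of v w] by (simp add: power2_sum)
  finally show "(energy_norm C (v + w))\<^sup>2 \<le> (energy_norm C v + energy_norm C w)\<^sup>2" .
qed (simp add: energy_norm_nonneg)

lemma energy_norm_sum: "energy_norm C (\<Sum>i\<in>I. g i) \<le> (\<Sum>i\<in>I. energy_norm C (g i))"
proof (induction I rule: infinite_finite_induct)
  case (insert i I)
  then show ?case using energy_norm_triangle[of "g i" "sum g I"] by simp
qed (simp_all add: energy_norm_0)

section \<open>Galerkin approximation\<close>

text \<open>
  Positive definiteness makes the image of \<open>V\<close> under \<open>C\<close> meet the orthogonal complement of
  \<open>V\<close> only in \<open>0\<close>. By dimension count the two spaces together span everything, so \<open>f\<close> splits
  as \<open>C u + w\<close> with \<open>w\<close> orthogonal to \<open>V\<close>.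
\<close>

lemma galerkin_solution_exists:
  assumes V: "subspace V"
  shows "\<exists>u\<in>V. \<forall>v\<in>V. C u \<bullet> v = f \<bullet> v"
proof -
  define W where "W = {y. \<forall>x\<in>V. orthogonal x y}"
  have W: "subspace W"
    unfolding W_def by (rule subspace_orthogonal_to_vectors)
  have CV: "subspace (C ` V)"
    using V lin by (simp add: linear_subspace_image)
  have "dim W + dim V = DIM('a)"
    using dim_subspace_orthogonal_to_vectors[OF V subspace_UNIV] by (simp add: W_def)
  moreover have "dim (C ` V) = dim V"
    using lin injective by (intro dim_image_eq) (auto intro: inj_on_subset)
  moreover have "C ` V \<inter> W = {0}"
  proof -
    have "x = 0" if "x \<in> C ` V" "x \<in> W" for x
    proof -
      from that obtain u where "u \<in> V" "x = C u" by auto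
      with that(2) have "C u \<bullet> u = 0"
        by (auto simp: W_def orthogonal_def inner_commute)
      then show ?thesis using eq_0_iff[of u] C_simps(4) \<open>x = C u\<close> by simp
    qed
    then show ?thesis using subspace_0[OF W] subspace_0[OF CV] by auto
  qed
  moreover define Z where "Z = {x + y |x y. x \<in> C ` V \<and> y \<in> W}"
  ultimately have "dim Z = DIM('a)"
    using dim_sums_Int[OF CV W] by simp
  then have "span Z = UNIV"
    by (simp add: dim_eq_full)
  moreover have "subspace Z"
    unfolding Z_def by (rule subspace_sums[OF CV W])
  ultimately have "Z = UNIV"
    by (simp flip: span_eq_iff)
  then have "f \<in> Z" by simp
  then obtain u w where "u \<in> V" "w \<in> W" "f = C u + w"
    unfolding Z_def by blast
  then show ?thesis
    by (intro bexI[of _ u]) (auto simp: inner_add W_def orthogonal_def inner_commute)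
qed

lemma galerkin_solution_unique:
  assumes "subspace V" "u \<in> V" "u' \<in> V"
    and "\<And>v. v \<in> V \<Longrightarrow> C u \<bullet> v = f \<bullet> v" "\<And>v. v \<in> V \<Longrightarrow> C u' \<bullet> v = f \<bullet> v"
  shows "u = u'"
proof -
  have "u - u' \<in> V" using assms(1-3) by (rule subspace_diff)
  then have "C (u - u') \<bullet> (u - u') = 0"
    using assms(4,5) by (simp add: C_simps inner_diff_left)
  then show ?thesis using eq_0_iff by simp
qed

text \<open>
  The Galerkin error is orthogonal to \<open>V\<close> in the energy inner product, so Pythagoras applies
  to \<open>C\<inverse> f - w = (C\<inverse> f - g) + (g - w)\<close> with the Galerkin solution \<open>g\<close> (Cea's lemma with
  constant one).
\<close>

lemma galerkin_best_approximation:
  assumes C: "C = shifted A t" and V: "subspace V" and w: "w \<in> V"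
  shows "energy_norm C (inv C f - galerkin A V f t) \<le> energy_norm C (inv C f - w)"
proof -
  define g where "g = galerkin A V f t"
  let ?P = "\<lambda>u. u \<in> V \<and> (\<forall>v\<in>V. A u \<bullet> v + t * (u \<bullet> v) = f \<bullet> v)"
  have P: "?P u \<longleftrightarrow> u \<in> V \<and> (\<forall>v\<in>V. C u \<bullet> v = f \<bullet> v)" for u
    by (simp add: C shifted_def inner_add_left)
  have "\<exists>!u. ?P u"
    unfolding P using galerkin_solution_exists[OF V, of f] galerkin_solution_unique[OF V] by metis
  from theI'[OF this] have g: "g \<in> V" "\<And>v. v \<in> V \<Longrightarrow> C g \<bullet> v = f \<bullet> v"
    unfolding g_def galerkin_def P by auto
  define e where "e = inv C f - g"
  have orth: "C e \<bullet> v = 0" if "v \<in> V" for v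
    using that g(2) by (simp add: e_def C_simps apply_inv inner_diff_left)
  have gw: "g - w \<in> V" using V g(1) w by (rule subspace_diff)
  have "C e \<bullet> e \<le> C e \<bullet> e + C (g - w) \<bullet> (g - w)"
    using nonneg by simp
  also have "\<dots> = C (e + (g - w)) \<bullet> (e + (g - w))"
    using orth[OF gw] sym[of "g - w" e] by (simp add: linear_add[OF lin] inner_add)
  finally show ?thesis
    by (simp add: energy_norm_def e_def g_def)
qed

section \<open>Extreme eigenvalues of self-adjoint operators\<close>

text \<open>
  The inner product meant is the energy inner product of \<open>C\<close>. A preconditioned operator
  \<open>B \<circ> C\<close> is self-adjoint for it, but in general not for the Euclidean one.
\<close>

definition self_adjoint :: "('a \<Rightarrow> 'a) \<Rightarrow> bool" where
  "self_adjoint T \<longleftrightarrow> linear T \<and> (\<forall>v w. C (T v) \<bullet> w = C (T w) \<bullet> v)"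

lemma self_adjointD:
  assumes "self_adjoint T"
  shows "linear T" "C (T v) \<bullet> w = C (T w) \<bullet> v"
  using assms by (auto simp: self_adjoint_def)

lemma self_adjoint_affine:
  assumes "self_adjoint T"
  shows "self_adjoint (\<lambda>v. a *\<^sub>R v + b *\<^sub>R T v)"
proof -
  note T = self_adjointD[OF assms]
  have "linear (\<lambda>v. a *\<^sub>R v + b *\<^sub>R T v)"
    by (rule linearI) (simp_all add: linear_add[OF T(1)] linear_scale[OF T(1)] algebra_simps)
  then show ?thesis
    unfolding self_adjoint_def using T(2) sym by (simp add: C_simps inner_add_left)
qed

end

text \<open>
  Otherwise the form would become negative at \<open>v - e *\<^sub>R S v\<close> for small \<open>e > 0\<close>: the term
  linear in \<open>e\<close> is \<open>- 2 * e * (S v \<bullet> S v)\<close>.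
\<close>

lemma nonneg_form_isotropic_imp_kernel:
  fixes S :: "'a::real_inner \<Rightarrow> 'a"
  assumes lin: "linear S" and sym: "\<And>v w. S v \<bullet> w = S w \<bullet> v" and nonneg: "\<And>v. S v \<bullet> v \<ge> 0"
    and v: "S v \<bullet> v = 0"
  shows "S v = 0"
proof (rule ccontr)
  assume nz: "S v \<noteq> 0"
  define w where "w = S v"
  define q where "q = S w \<bullet> w"
  \<comment> \<open>The denominator is \<open>q + 1\<close> because \<open>q\<close> itself may vanish.\<close>
  define e where "e = (w \<bullet> w) / (q + 1)"
  have q: "q \<ge> 0" by (simp add: q_def nonneg)
  have ww: "w \<bullet> w > 0" using nz by (simp add: w_def)
  have e: "e > 0" "e * q < w \<bullet> w"
    using q ww by (simp_all add: e_def field_simps)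
  have "0 \<le> S (v - e *\<^sub>R w) \<bullet> (v - e *\<^sub>R w)" by (rule nonneg)
  also have "\<dots> = e * (e * q - 2 * (w \<bullet> w))"
    using v sym[of w v]
    by (simp add: linear_diff[OF lin] linear_scale[OF lin] inner_diff q_def flip: w_def)
       (simp add: algebra_simps)
  also have "\<dots> < 0" using e ww by (intro mult_pos_neg) linarith+
  finally show False by simp
qed

context spd_operator
begin

text \<open>
  Let the Rayleigh quotient attain its maximum \<open>l\<close> over the compact unit sphere at \<open>v\<^sub>0\<close>. Then
  \<open>C (l I - T)\<close> is a nonnegative form that vanishes at \<open>v\<^sub>0\<close>, hence \<open>v\<^sub>0\<close> is in its kernel and
  is an eigenvector for \<open>l\<close>.
\<close>

lemma Rayleigh_max_eigenvalue:
  assumes T: "self_adjoint T"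
  shows "\<exists>l\<in>eigenvalues T. \<forall>v. C (T v) \<bullet> v \<le> l * (C v \<bullet> v)"
proof -
  note Tl = self_adjointD(1)[OF T] and Ts = self_adjointD(2)[OF T]
  let ?R = "\<lambda>v. C (T v) \<bullet> v / (C v \<bullet> v)"
  let ?S = "sphere 0 1 :: 'a set"
  have "C v \<bullet> v \<noteq> 0" if "v \<in> ?S" for v
    using that pos[of v] by (cases "v = 0") auto
  then have cont: "continuous_on ?S ?R"
    by (intro continuous_intros linear_continuous_on_compose[OF _ lin]
        linear_continuous_on_compose[OF _ Tl]) auto
  obtain b :: 'a where "b \<in> Basis" using nonempty_Basis by blast
  then have "b \<in> ?S" by simp
  then have ne: "?S \<noteq> {}" by blast
  obtain v0 where v0: "v0 \<in> ?S" "\<And>v. v \<in> ?S \<Longrightarrow> ?R v \<le> ?R v0"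
    using continuous_attains_sup[OF compact_sphere ne cont] by blast
  define l where "l = ?R v0"
  have nz: "v0 \<noteq> 0" using v0(1) by auto
  have max: "C (T v) \<bullet> v \<le> l * (C v \<bullet> v)" for v
  proof (cases "v = 0")
    case False
    let ?v = "v /\<^sub>R norm v"
    have "?R ?v \<le> l" unfolding l_def by (rule v0(2)) (simp add: False)
    moreover have "?R ?v = ?R v"
      using False by (simp add: linear_scale[OF Tl] C_simps)
    ultimately have "?R v \<le> l" by (simp only:)
    then show ?thesis using pos[OF False] by (simp add: pos_divide_le_eq)
  qed (simp add: C_simps linear_0[OF Tl])
  define S where "S v = C (l *\<^sub>R v - T v)" for v
  have "S v0 = 0"
  proof (rule nonneg_form_isotropic_imp_kernel[of S])
    show "linear S" unfolding S_def
      by (rule linearI) (simp_all add: linear_add[OF Tl] linear_scale[OF Tl] C_simps algebra_simps)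
    show "S v \<bullet> w = S w \<bullet> v" for v w
      using sym[of v w] Ts[of v w] by (simp add: S_def C_simps inner_diff_left)
    show "S v \<bullet> v \<ge> 0" for v
      using max[of v] by (simp add: S_def C_simps inner_diff_left)
    show "S v0 \<bullet> v0 = 0"
      using pos[OF nz] by (simp add: S_def C_simps inner_diff_left l_def)
  qed
  then have "T v0 = l *\<^sub>R v0"
    using injective C_simps(4) unfolding S_def by (metis injD eq_iff_diff_eq_0)
  with nz max show ?thesis by (auto simp: eigenvalues_def)
qed

lemma Rayleigh_min_eigenvalue:
  assumes T: "self_adjoint T"
  shows "\<exists>l\<in>eigenvalues T. \<forall>v. l * (C v \<bullet> v) \<le> C (T v) \<bullet> v"
proof -
  have "self_adjoint (\<lambda>v. - T v)"
    using self_adjoint_affine[OF T, of 0 "-1"] by simp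
  from Rayleigh_max_eigenvalue[OF this] obtain l where
    "l \<in> eigenvalues (\<lambda>v. - T v)" "\<And>v. - (C (T v) \<bullet> v) \<le> l * (C v \<bullet> v)"
    by (auto simp: C_simps)
  moreover from this(1) have "- l \<in> eigenvalues T"
    by (auto simp: eigenvalues_def) (metis neg_equal_iff_equal add.inverse_inverse)
  ultimately show ?thesis by (intro bexI[of _ "- l"]) (auto simp: minus_le_iff)
qed

text \<open>
  Eigenvectors for distinct eigenvalues are orthogonal in the energy inner product, hence
  linearly independent. Without finiteness, \<open>Max\<close> and \<open>Min\<close> of the set of eigenvalues would
  carry no information.
\<close>

lemma finite_eigenvalues:
  assumes T: "self_adjoint T"
  shows "finite (eigenvalues T)"
proof -
  have "\<exists>v. v \<noteq> 0 \<and> T v = l *\<^sub>R v" if "l \<in> eigenvalues T" for l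
    using that by (simp add: eigenvalues_def)
  then obtain e where e: "\<And>l. l \<in> eigenvalues T \<Longrightarrow> e l \<noteq> 0 \<and> T (e l) = l *\<^sub>R e l"
    by metis
  have inj: "inj_on e (eigenvalues T)"
    by (rule inj_onI) (metis e scaleR_cancel_right)
  have orth: "C (e k) \<bullet> e l = 0" if "k \<in> eigenvalues T" "l \<in> eigenvalues T" "k \<noteq> l" for k l
  proof -
    have "k * (C (e k) \<bullet> e l) = l * (C (e k) \<bullet> e l)"
      using self_adjointD(2)[OF T, of "e k" "e l"] that e sym[of "e k" "e l"] by (simp add: C_simps)
    then show ?thesis using that by simp
  qed
  have "independent (e ` eigenvalues T)"
    unfolding independent_explicit_module
  proof (intro allI impI)
    fix F a v
    assume F: "finite F" "F \<subseteq> e ` eigenvalues T" and sum: "(\<Sum>w\<in>F. a w *\<^sub>R w) = 0" and v: "v \<in> F"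
    have "0 = C v \<bullet> (\<Sum>w\<in>F. a w *\<^sub>R w)" by (simp add: sum)
    also have "\<dots> = (\<Sum>w\<in>F. a w * (C v \<bullet> w))" by (simp add: inner_sum_right)
    also have "\<dots> = (\<Sum>w\<in>{v}. a w * (C v \<bullet> w))"
    proof (rule sum.mono_neutral_right)
      show "\<forall>w\<in>F - {v}. a w * (C v \<bullet> w) = 0"
      proof
        fix w assume w: "w \<in> F - {v}"
        obtain k l where "k \<in> eigenvalues T" "v = e k" "l \<in> eigenvalues T" "w = e l"
          using F(2) v w by blast
        then show "a w * (C v \<bullet> w) = 0" using w orth[of k l] by auto
      qed
    qed (use F v in auto)
    finally show "a v = 0"
      using pos[of v] e F(2) v by auto
  qed
  then have "finite (e ` eigenvalues T)"
    by (rule independent_imp_finite)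
  then show ?thesis using inj by (rule finite_imageD)
qed

lemma Rayleigh_bounds:
  assumes T: "self_adjoint T"
  shows "Min (eigenvalues T) * (C v \<bullet> v) \<le> C (T v) \<bullet> v"
    and "C (T v) \<bullet> v \<le> Max (eigenvalues T) * (C v \<bullet> v)"
proof -
  note fin = finite_eigenvalues[OF T]
  obtain l where l: "l \<in> eigenvalues T" "l * (C v \<bullet> v) \<le> C (T v) \<bullet> v"
    using Rayleigh_min_eigenvalue[OF T] by blast
  show "Min (eigenvalues T) * (C v \<bullet> v) \<le> C (T v) \<bullet> v"
    using Min_le[OF fin l(1)] l(2) nonneg[of v] by (meson mult_right_mono order_trans)
  obtain l where l: "l \<in> eigenvalues T" "C (T v) \<bullet> v \<le> l * (C v \<bullet> v)"
    using Rayleigh_max_eigenvalue[OF T] by blast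
  show "C (T v) \<bullet> v \<le> Max (eigenvalues T) * (C v \<bullet> v)"
    using Max_ge[OF fin l(1)] l(2) nonneg[of v] by (meson mult_right_mono order_trans)
qed

lemma eigenvalues_nonempty: "self_adjoint T \<Longrightarrow> eigenvalues T \<noteq> {}"
  using Rayleigh_max_eigenvalue by blast

end

section \<open>The Chebyshev recurrence\<close>

text \<open>
  The recurrence shared by both kinds of Chebyshev polynomials, evaluated at an operator \<open>X\<close>
  and applied to a vector. Multiplication by a real number \<open>h\<close> is the special case that
  yields the values of the polynomials at \<open>h\<close>.
\<close>

fun three_term :: "('a::real_vector \<Rightarrow> 'a) \<Rightarrow> 'a \<Rightarrow> 'a \<Rightarrow> nat \<Rightarrow> 'a" where
  "three_term X a b 0 = a"
| "three_term X a b (Suc 0) = b"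
| "three_term X a b (Suc (Suc k)) = 2 *\<^sub>R X (three_term X a b (Suc k)) - three_term X a b k"

abbreviation cheb_T :: "('a::real_vector \<Rightarrow> 'a) \<Rightarrow> 'a \<Rightarrow> nat \<Rightarrow> 'a" where
  "cheb_T X u \<equiv> three_term X u (X u)"

text \<open>
  The index is shifted by one against the usual one: \<open>cheb_U X u k\<close> is \<open>U\<^sub>k\<^sub>-\<^sub>1(X) u\<close>, with
  \<open>U\<^sub>-\<^sub>1 = 0\<close>.
\<close>

abbreviation cheb_U :: "('a::real_vector \<Rightarrow> 'a) \<Rightarrow> 'a \<Rightarrow> nat \<Rightarrow> 'a" where
  "cheb_U X u \<equiv> three_term X 0 u"

lemma cheb_T_eq_cheb_U:
  assumes "linear X"
  shows "cheb_T X u k = cheb_U X u (Suc k) - X (cheb_U X u k)"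
proof (induction k rule: induct_nat_012)
  case (ge2 k)
  show ?case
    unfolding three_term.simps(3) ge2
    by (simp add: linear_diff[OF assms] linear_add[OF assms] linear_scale[OF assms] algebra_simps)
qed (simp_all add: linear_0[OF assms] scaleR_2)

text \<open>
  With \<open>y = exp x\<close> this is \<open>T\<^sub>k(cosh x) = cosh (k x)\<close>.
\<close>

lemma cheb_T_Joukowski:
  fixes y :: real
  assumes "y \<noteq> 0" and h: "h = (y + 1 / y) / 2"
  shows "cheb_T ((*) h) 1 k = (y ^ k + 1 / y ^ k) / 2"
proof (induction k rule: induct_nat_012)
  case (ge2 k)
  have "cheb_T ((*) h) 1 (Suc (Suc k)) = 2 * h * cheb_T ((*) h) 1 (Suc k) - cheb_T ((*) h) 1 k"
    by simp
  also have "\<dots> = (y ^ Suc (Suc k) + 1 / y ^ Suc (Suc k)) / 2"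
    unfolding ge2 using assms(1) by (simp add: h field_simps)
  finally show ?case .
qed (simp_all add: h)

context spd_operator
begin

text \<open>
  The polynomial identity \<open>U\<^sub>k\<^sup>2 - 2 X U\<^sub>k U\<^sub>k\<^sub>-\<^sub>1 + U\<^sub>k\<^sub>-\<^sub>1\<^sup>2 = 1\<close> as an identity of quadratic forms.
  The left-hand side is a conserved quantity of the recurrence, because \<open>X\<close> can be moved
  between the two arguments of the form. Substituting \<open>T\<^sub>k = U\<^sub>k - X U\<^sub>k\<^sub>-\<^sub>1\<close> turns it into the Pell identity
  \<open>T\<^sub>k\<^sup>2 + (1 - X\<^sup>2) U\<^sub>k\<^sub>-\<^sub>1\<^sup>2 = 1\<close>.
\<close>

lemma cheb_U_invariant:
  assumes X: "self_adjoint X"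
  shows "C (cheb_U X u (Suc k)) \<bullet> cheb_U X u (Suc k)
    - 2 * (C (X (cheb_U X u (Suc k))) \<bullet> cheb_U X u k) + C (cheb_U X u k) \<bullet> cheb_U X u k = C u \<bullet> u"
proof (induction k)
  case (Suc k)
  define a b where "a = cheb_U X u k" and "b = cheb_U X u (Suc k)"
  have "cheb_U X u (Suc (Suc k)) = 2 *\<^sub>R X b - a"
    by (simp add: a_def b_def)
  with Suc.IH show ?case
    using self_adjointD(2)[OF X, of b a] self_adjointD(2)[OF X, of b "X b"] sym[of "X b" a]
    unfolding a_def[symmetric] b_def[symmetric]
    by (simp add: C_simps linear_diff[OF self_adjointD(1)[OF X]]
        linear_scale[OF self_adjointD(1)[OF X]] inner_diff)
qed simp

text \<open>
  The form of \<open>1 - X\<^sup>2\<close> is nonnegative because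
  \<open>2 (1 - X\<^sup>2) = (1 + X) (1 - X) (1 + X) + (1 - X) (1 + X) (1 - X)\<close> and both \<open>1 - X\<close> and
  \<open>1 + X\<close> have nonnegative forms.
\<close>

lemma energy_contraction:
  assumes X: "self_adjoint X" and bd: "\<And>v. \<bar>C (X v) \<bullet> v\<bar> \<le> C v \<bullet> v"
  shows "C (X v) \<bullet> X v \<le> C v \<bullet> v"
proof -
  note Xl = self_adjointD(1)[OF X] and Xs = self_adjointD(2)[OF X]
  have "0 \<le> (C (v + X v) \<bullet> (v + X v) - C (X (v + X v)) \<bullet> (v + X v))
      + (C (v - X v) \<bullet> (v - X v) + C (X (v - X v)) \<bullet> (v - X v))"
    using bd[of "v + X v"] bd[of "v - X v"] by linarith
  also have "\<dots> = 2 * (C v \<bullet> v - C (X v) \<bullet> X v)"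
    using Xs[of "X v" v] by (simp add: C_simps linear_add[OF Xl] linear_diff[OF Xl] inner_add inner_diff)
  finally show ?thesis by simp
qed

text \<open>
  In the Pell identity the term \<open>(1 - X\<^sup>2) U\<^sub>k\<^sub>-\<^sub>1\<^sup>2\<close> is nonnegative. This is the operator form of
  the bound \<open>\<bar>T\<^sub>k\<bar> \<le> 1\<close> on \<open>[-1, 1]\<close>.
\<close>

lemma energy_norm_cheb_T_le:
  assumes X: "self_adjoint X" and bd: "\<And>v. \<bar>C (X v) \<bullet> v\<bar> \<le> C v \<bullet> v"
  shows "energy_norm C (cheb_T X u k) \<le> energy_norm C u"
proof -
  define a b where "a = cheb_U X u k" and "b = cheb_U X u (Suc k)"
  have "cheb_T X u k = b - X a"
    unfolding a_def b_def by (rule cheb_T_eq_cheb_U[OF self_adjointD(1)[OF X]])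
  then have "C (cheb_T X u k) \<bullet> cheb_T X u k = C b \<bullet> b - 2 * (C (X b) \<bullet> a) + C (X a) \<bullet> X a"
    using self_adjointD(2)[OF X, of b a] sym[of "X a" b] by (simp add: C_simps inner_diff)
  also have "\<dots> \<le> C b \<bullet> b - 2 * (C (X b) \<bullet> a) + C a \<bullet> a"
    using energy_contraction[OF X bd, of a] by simp
  also have "\<dots> = C u \<bullet> u"
    unfolding a_def b_def by (rule cheb_U_invariant[OF X])
  finally show ?thesis by (simp add: energy_norm_def)
qed

end

text \<open>
  As \<open>X = h I - g T\<close>, the vector \<open>T\<^sub>k(X) u\<close> is a polynomial in \<open>T\<close> applied to \<open>u\<close> whose
  constant term is \<open>T\<^sub>k(h)\<close>. Every other term contains \<open>T u\<close>, so that it lies in the space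
  reached from \<open>V 1\<close> after \<open>k - 1\<close> further applications of \<open>T\<close>.
\<close>

lemma cheb_T_in_krylov:
  fixes V :: "nat \<Rightarrow> 'a::real_vector set"
  assumes T: "linear T" and V: "\<And>k. subspace (V k)" and mono: "\<And>k. V k \<subseteq> V (Suc k)"
    and T_V: "\<And>k v. v \<in> V k \<Longrightarrow> T v \<in> V (Suc k)" and Tu: "T u \<in> V 1"
    and X: "\<And>v. X v = h *\<^sub>R v - g *\<^sub>R T v"
  shows "cheb_T ((*) h) 1 k *\<^sub>R u - cheb_T X u k \<in> V k"
proof -
  have mono': "i \<le> j \<Longrightarrow> V i \<subseteq> V j" for i j
    using mono by (rule lift_Suc_mono_le)
  show ?thesis
  proof (induction k rule: induct_nat_012)
    case 0
    then show ?case using subspace_0[OF V] by simp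
  next
    case 1
    have "g *\<^sub>R T u \<in> V 1" using Tu V by (simp add: subspace_scale)
    then show ?case by (simp add: X)
  next
    case (ge2 k)
    define a b where "a = cheb_T ((*) h) 1 k" and "b = cheb_T ((*) h) 1 (Suc k)"
    define x y where "x = cheb_T X u k" and "y = cheb_T X u (Suc k)"
    define p q where "p = a *\<^sub>R u - x" and "q = b *\<^sub>R u - y"
    have pq: "p \<in> V (Suc (Suc k))" "q \<in> V (Suc (Suc k))" "T q \<in> V (Suc (Suc k))"
      using ge2 mono'[of k "Suc (Suc k)"] mono'[of "Suc k" "Suc (Suc k)"] T_V[of q "Suc k"]
      by (auto simp: a_def b_def x_def y_def p_def q_def)
    have Tu': "T u \<in> V (Suc (Suc k))"
      using Tu mono'[of 1 "Suc (Suc k)"] by auto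
    have "cheb_T ((*) h) 1 (Suc (Suc k)) *\<^sub>R u - cheb_T X u (Suc (Suc k))
        = (2 * h) *\<^sub>R q - (2 * g) *\<^sub>R T q + (2 * g * b) *\<^sub>R T u - p"
    proof -
      have "cheb_T ((*) h) 1 (Suc (Suc k)) = 2 * h * b - a"
        by (simp add: a_def b_def)
      moreover have "cheb_T X u (Suc (Suc k)) = 2 *\<^sub>R X y - x"
        by (simp add: x_def y_def)
      ultimately show ?thesis
        unfolding p_def q_def
        by (simp only: X linear_diff[OF T] linear_scale[OF T]) (simp add: algebra_simps)
    qed
    also have "\<dots> \<in> V (Suc (Suc k))"
      using pq Tu' V by (intro subspace_add subspace_diff subspace_scale)
    finally show ?case .
  qed
qed

context spd_operator
begin

text \<open>
  The affine map \<open>X = h I - g T\<close> is chosen so that the spectral interval \<open>[lo, hi]\<close> of \<open>T\<close> goes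
  to \<open>[-1, 1]\<close>; then \<open>h = (\<rho> + 1 / \<rho>) / 2\<close>, and therefore
  \<open>T\<^sub>m(h) = (\<rho>\<^sup>m + \<rho>\<^sup>-\<^sup>m) / 2 \<ge> 1 / (2 \<rho>\<^sup>m)\<close>.
  The map degenerates if \<open>lo = hi\<close>; in that case \<open>T\<close> is a multiple of the identity and
  \<open>u\<close> itself belongs to the space.
\<close>

lemma krylov_chebyshev_approximation:
  fixes V :: "nat \<Rightarrow> 'a set"
  assumes T: "self_adjoint T" and pos_T: "\<And>l. l \<in> eigenvalues T \<Longrightarrow> l > 0"
    and V: "\<And>k. subspace (V k)" and mono: "\<And>k. V k \<subseteq> V (Suc k)"
    and T_V: "\<And>k v. v \<in> V k \<Longrightarrow> T v \<in> V (Suc k)" and Tu: "T u \<in> V 1" and m: "m \<ge> 1"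
  defines "\<rho> \<equiv> (sqrt (spectral_cond T) - 1) / (sqrt (spectral_cond T) + 1)"
  shows "\<exists>w\<in>V m. energy_norm C (u - w) \<le> 2 * \<rho> ^ m * energy_norm C u"
proof -
  define lo hi where "lo = Min (eigenvalues T)" and "hi = Max (eigenvalues T)"
  note fin = finite_eigenvalues[OF T] and ne = eigenvalues_nonempty[OF T]
  note Tl = self_adjointD(1)[OF T]
  have lo: "lo > 0" and lohi: "lo \<le> hi"
    using pos_T Min_in[OF fin ne] Min_le[OF fin Max_in[OF fin ne]] by (auto simp: lo_def hi_def)
  note bounds = Rayleigh_bounds[OF T, folded lo_def hi_def]
  show ?thesis
  proof (cases "lo = hi")
    case True
    have "T u \<in> V m"
      using Tu lift_Suc_mono_le[of V, OF mono m] by blast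
    then have "(1 / lo) *\<^sub>R T u \<in> V m"
      by (rule subspace_scale[OF V])
    moreover have "u - (1 / lo) *\<^sub>R T u = 0"
    proof -
      define S where "S v = C (v - (1 / lo) *\<^sub>R T v)" for v
      have iso: "S v \<bullet> v = 0" for v
      proof -
        have "C (T v) \<bullet> v = lo * (C v \<bullet> v)"
          using bounds[of v] unfolding True by (rule antisym[rotated])
        then show ?thesis using lo by (simp add: S_def C_simps inner_diff_left)
      qed
      have "S u = 0"
      proof (rule nonneg_form_isotropic_imp_kernel[of S])
        show "linear S" unfolding S_def
          by (rule linearI) (simp_all add: linear_add[OF Tl] linear_scale[OF Tl] C_simps algebra_simps)
        show "S v \<bullet> w = S w \<bullet> v" for v w
          using sym[of v w] self_adjointD(2)[OF T, of v w] by (simp add: S_def C_simps inner_diff_left)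
      qed (simp_all add: iso)
      then show ?thesis
        using injective C_simps(4) unfolding S_def by (metis injD)
    qed
    moreover have "\<rho> = 0"
      using True lo by (simp add: \<rho>_def spectral_cond_def flip: lo_def hi_def)
    ultimately show ?thesis
      using m by (intro bexI[of _ "(1 / lo) *\<^sub>R T u"]) (simp_all add: energy_norm_0 energy_norm_nonneg)
  next
    case False
    with lohi have lt: "lo < hi" by simp
    define h g where "h = (hi + lo) / (hi - lo)" and "g = 2 / (hi - lo)"
    define X where "X v = h *\<^sub>R v - g *\<^sub>R T v" for v
    have X: "self_adjoint X"
      using self_adjoint_affine[OF T, of h "- g"] by (simp add: X_def[abs_def])
    have X_bd: "\<bar>C (X v) \<bullet> v\<bar> \<le> C v \<bullet> v" for v
    proof -
      have "C (X v) \<bullet> v = ((hi + lo) * (C v \<bullet> v) - 2 * (C (T v) \<bullet> v)) / (hi - lo)"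
        using lt by (simp add: X_def C_simps inner_diff_left h_def g_def diff_divide_distrib)
      moreover have "\<bar>(hi + lo) * (C v \<bullet> v) - 2 * (C (T v) \<bullet> v)\<bar> \<le> (hi - lo) * (C v \<bullet> v)"
        using bounds[of v] by (simp add: abs_le_iff algebra_simps)
      ultimately show ?thesis using lt by (simp add: abs_divide pos_divide_le_eq mult.commute)
    qed
    define \<sigma> where "\<sigma> = sqrt (spectral_cond T)"
    have \<sigma>2: "\<sigma>\<^sup>2 = hi / lo"
      using lo lohi by (simp add: \<sigma>_def spectral_cond_def flip: lo_def hi_def)
    have \<sigma>: "\<sigma> > 1"
      using lo lt by (simp add: \<sigma>_def spectral_cond_def flip: lo_def hi_def)
    have \<rho>: "\<rho> = (\<sigma> - 1) / (\<sigma> + 1)" "\<rho> > 0"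
      using \<sigma> by (simp_all add: \<rho>_def flip: \<sigma>_def)
    have "h = (\<sigma>\<^sup>2 + 1) / (\<sigma>\<^sup>2 - 1)"
      using lo lt unfolding \<sigma>2 h_def by (simp add: field_simps)
    also have "\<dots> = (\<rho> + 1 / \<rho>) / 2"
    proof -
      have "\<sigma>\<^sup>2 - 1 = (\<sigma> - 1) * (\<sigma> + 1)" by (simp add: power2_eq_square algebra_simps)
      then show ?thesis using \<sigma> unfolding \<rho>
        by (simp add: divide_simps) (simp add: power2_eq_square algebra_simps)
    qed
    finally have h: "h = (\<rho> + 1 / \<rho>) / 2" .
    define \<tau> where "\<tau> = cheb_T ((*) h) 1 m"
    have \<tau>: "\<tau> = (\<rho> ^ m + 1 / \<rho> ^ m) / 2"
      unfolding \<tau>_def using \<rho>(2) h by (intro cheb_T_Joukowski) simp_all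
    have \<tau>_pos: "\<tau> > 0" and \<tau>_inv: "1 / \<tau> \<le> 2 * \<rho> ^ m"
    proof -
      have p: "\<rho> ^ m > 0" using \<rho> by simp
      then show "\<tau> > 0" by (simp add: \<tau> add_pos_pos)
      have "1 / (2 * \<rho> ^ m) \<le> \<tau>" using p by (simp add: \<tau> field_simps)
      then have "1 / \<tau> \<le> 1 / (1 / (2 * \<rho> ^ m))" using p by (intro divide_left_mono) (auto simp: \<open>\<tau> > 0\<close>)
      then show "1 / \<tau> \<le> 2 * \<rho> ^ m" by simp
    qed
    \<comment> \<open>\<open>w\<close> is chosen so that \<open>u - w\<close> is \<open>Q(T) u\<close> for the scaled Chebyshev polynomial with \<open>Q(0) = 1\<close>.\<close>
    define w where "w = (1 / \<tau>) *\<^sub>R (\<tau> *\<^sub>R u - cheb_T X u m)"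
    have "w \<in> V m"
      unfolding w_def \<tau>_def
      by (rule subspace_scale[OF V], rule cheb_T_in_krylov[of T V, OF Tl V mono T_V Tu X_def])
    moreover have "energy_norm C (u - w) \<le> 2 * \<rho> ^ m * energy_norm C u"
    proof -
      have "u - w = (1 / \<tau>) *\<^sub>R cheb_T X u m"
        using \<tau>_pos by (simp add: w_def scaleR_diff_right)
      then have "energy_norm C (u - w) = 1 / \<tau> * energy_norm C (cheb_T X u m)"
        using \<tau>_pos by (simp add: energy_norm_scaleR del: scaleR_scaleR)
      also have "\<dots> \<le> 2 * \<rho> ^ m * energy_norm C u"
        using energy_norm_cheb_T_le[OF X X_bd, of u m] \<tau>_inv \<tau>_pos \<rho>(2)
        by (intro mult_mono) (simp_all add: energy_norm_nonneg)
      finally show ?thesis .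
    qed
    ultimately show ?thesis by blast
  qed
qed

end

section \<open>The search space of preconditioned conjugate gradients\<close>

lemma pcg_SucE:
  assumes "pcg D B f k = (u, r, z, p)" "pcg D B f (Suc k) = (u', r', z', p')" "r \<noteq> 0"
  obtains \<beta> where "r' = r - ((r \<bullet> z) / (D p \<bullet> p)) *\<^sub>R D p" "z' = B r'"
    "p' = (if r' = 0 then 0 else z' + \<beta> *\<^sub>R p)"
proof (rule that)
  have step: "pcg_step D B (u, r, z, p) = (u', r', z', p')"
    using assms(1,2) by simp
  show r': "r' = r - ((r \<bullet> z) / (D p \<bullet> p)) *\<^sub>R D p" and z': "z' = B r'"
    using step assms(3) by (auto simp: Let_def)
  show "p' = (if r' = 0 then 0 else z' + ((r' \<bullet> z') / (r \<bullet> z)) *\<^sub>R p)"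
    using step assms(3) by (auto simp: Let_def)
qed

text \<open>
  The last equation expresses that a residual is orthogonal to the preceding search direction.
  It shows that \<open>r \<bullet> p = r \<bullet> B r > 0\<close> as long as the residual does not vanish, so the
  search direction is then nonzero and the step length is well defined and positive.
\<close>

lemma pcg_invariant:
  assumes "spd_operator D" "spd_operator B" "pcg D B f k = (u, r, z, p)"
  shows "z = B r" "r = 0 \<Longrightarrow> p = 0" "r \<bullet> p = r \<bullet> z"
proof -
  interpret D: spd_operator D by fact
  interpret B: spd_operator B by fact
  have "z = B r \<and> (r = 0 \<longrightarrow> p = 0) \<and> r \<bullet> p = r \<bullet> z"
    using assms(3)
  proof (induction k arbitrary: u r z p)
    case 0
    then show ?case by (auto simp: B.C_simps)
  next
    case (Suc k)
    obtain u0 r0 z0 p0 where st: "pcg D B f k = (u0, r0, z0, p0)"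
      by (cases "pcg D B f k")
    note IH = Suc.IH[OF st]
    show ?case
    proof (cases "r0 = 0")
      case True
      then show ?thesis using Suc.prems st IH by auto
    next
      case False
      have "r0 \<bullet> p0 > 0" using IH B.pos[OF False] by (simp add: inner_commute)
      then have "p0 \<noteq> 0" by auto
      then have "D p0 \<bullet> p0 \<noteq> 0" using D.pos by force
      moreover obtain b where step: "r = r0 - ((r0 \<bullet> z0) / (D p0 \<bullet> p0)) *\<^sub>R D p0" "z = B r"
          "p = (if r = 0 then 0 else z + b *\<^sub>R p0)"
        using pcg_SucE[OF st Suc.prems False] .
      ultimately have "r \<bullet> p0 = 0"
        using IH by (simp add: step(1) inner_diff_left)
      then show ?thesis
        using step(2,3) by (simp add: inner_add_right)
    qed
  qed
  then show "z = B r" "r = 0 \<Longrightarrow> p = 0" "r \<bullet> p = r \<bullet> z" by auto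
qed

definition pcg_space :: "('a::real_inner \<Rightarrow> 'a) \<Rightarrow> ('a \<Rightarrow> 'a) \<Rightarrow> 'a \<Rightarrow> nat \<Rightarrow> 'a set" where
  "pcg_space D B f k = span (pcg_dir D B f ` {0..<k})"

lemma subspace_pcg_space: "subspace (pcg_space D B f k)"
  by (simp add: pcg_space_def)

lemma pcg_space_Suc: "pcg_space D B f k \<subseteq> pcg_space D B f (Suc k)"
  unfolding pcg_space_def by (intro span_mono image_mono) auto

lemma pcg_dir_in_pcg_space: "i < k \<Longrightarrow> pcg_dir D B f i \<in> pcg_space D B f k"
  unfolding pcg_space_def by (intro span_base) auto

text \<open>
  The update \<open>p = z + \<beta> *\<^sub>R p\<^sub>0\<close>, solved for \<open>z\<close>. At termination \<open>p\<close> is set to \<open>0\<close>, but then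
  \<open>z\<close> vanishes too.
\<close>

lemma pcg_residual_in_pcg_space:
  assumes "spd_operator D" "spd_operator B" "pcg D B f k = (u, r, z, p)"
  shows "z \<in> pcg_space D B f (Suc k)"
proof -
  interpret B: spd_operator B by fact
  note inv = pcg_invariant[OF assms(1,2)]
  note sub = subspace_pcg_space[of D B f "Suc k"]
  have p: "p = pcg_dir D B f k" by (simp add: pcg_dir_def assms(3))
  show ?thesis
  proof (cases "r = 0")
    case True
    then show ?thesis using inv(1)[OF assms(3)] subspace_0[OF sub] by (simp add: B.C_simps)
  next
    case r: False
    show ?thesis
    proof (cases k)
      case 0
      then show ?thesis using assms(3) p pcg_dir_in_pcg_space[of k "Suc k" D B f] by auto
    next
      case (Suc j)
      obtain u0 r0 z0 p0 where st: "pcg D B f j = (u0, r0, z0, p0)"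
        by (cases "pcg D B f j")
      then have p0: "p0 = pcg_dir D B f j" by (simp add: pcg_dir_def)
      have st': "pcg D B f (Suc j) = (u, r, z, p)"
        using assms(3) Suc by simp
      have "r0 \<noteq> 0" using st' st r by auto
      then obtain b where "p = z + b *\<^sub>R p0"
        using pcg_SucE[OF st st'] r by metis
      then have "z = p - b *\<^sub>R p0" by simp
      then show ?thesis
        using subspace_diff[OF sub pcg_dir_in_pcg_space[of k] subspace_scale[OF sub pcg_dir_in_pcg_space[of j]]]
        unfolding p p0 Suc by simp
    qed
  qed
qed

text \<open>
  Applying \<open>B\<close> to the residual update \<open>r' = r - \<alpha> *\<^sub>R D p\<close> exhibits \<open>B (D p)\<close> as a multiple of
  \<open>z - z'\<close>, because \<open>\<alpha> \<noteq> 0\<close>.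
\<close>

lemma preconditioned_pcg_dir:
  assumes "spd_operator D" "spd_operator B"
  shows "B (D (pcg_dir D B f k)) \<in> pcg_space D B f (Suc (Suc k))"
proof -
  interpret D: spd_operator D by fact
  interpret B: spd_operator B by fact
  note sub = subspace_pcg_space[of D B f "Suc (Suc k)"]
  obtain u r z p where st: "pcg D B f k = (u, r, z, p)"
    by (cases "pcg D B f k")
  obtain u' r' z' p' where st': "pcg D B f (Suc k) = (u', r', z', p')"
    by (cases "pcg D B f (Suc k)")
  note inv = pcg_invariant[OF assms st] and inv' = pcg_invariant[OF assms st']
  have p: "pcg_dir D B f k = p" by (simp add: pcg_dir_def st)
  show ?thesis
  proof (cases "r = 0")
    case True
    then show ?thesis using inv(2) p subspace_0[OF sub] by (simp add: D.C_simps B.C_simps)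
  next
    case False
    define \<alpha> where "\<alpha> = (r \<bullet> z) / (D p \<bullet> p)"
    have rz: "r \<bullet> z > 0" using inv(1) B.pos[OF False] by (simp add: inner_commute)
    then have "p \<noteq> 0" using inv(3) by auto
    then have \<alpha>: "\<alpha> \<noteq> 0" using rz D.pos[of p] by (simp add: \<alpha>_def)
    have "r' = r - \<alpha> *\<^sub>R D p"
      unfolding \<alpha>_def using pcg_SucE[OF st st' False] .
    then have "z' = z - \<alpha> *\<^sub>R B (D p)"
      using inv(1) inv'(1) by (simp add: B.C_simps)
    then have "B (D p) = (1 / \<alpha>) *\<^sub>R (z - z')" using \<alpha> by simp
    moreover have "z \<in> pcg_space D B f (Suc (Suc k))" "z' \<in> pcg_space D B f (Suc (Suc k))"
      using pcg_residual_in_pcg_space[OF assms st] pcg_residual_in_pcg_space[OF assms st']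
        pcg_space_Suc by blast+
    ultimately show ?thesis
      unfolding p by (auto intro: subspace_scale[OF sub] subspace_diff[OF sub])
  qed
qed

lemma preconditioned_pcg_space:
  assumes D: "spd_operator D" and B: "spd_operator B" and v: "v \<in> pcg_space D B f k"
  shows "B (D v) \<in> pcg_space D B f (Suc k)"
proof -
  have BD: "linear (\<lambda>v. B (D v))"
    using linear_compose[OF spd_operator.lin[OF D] spd_operator.lin[OF B]] by (simp add: o_def)
  have "(\<lambda>v. B (D v)) ` pcg_space D B f k = span ((\<lambda>v. B (D v)) ` pcg_dir D B f ` {0..<k})"
    unfolding pcg_space_def by (rule linear_span_image[OF BD, symmetric])
  also have "\<dots> \<subseteq> pcg_space D B f (Suc k)"
  proof (rule span_minimal[OF _ subspace_pcg_space], clarsimp)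
    fix i assume "i < k"
    then have "pcg_space D B f (Suc (Suc i)) \<subseteq> pcg_space D B f (Suc k)"
      unfolding pcg_space_def by (intro span_mono image_mono) auto
    then show "B (D (pcg_dir D B f i)) \<in> pcg_space D B f (Suc k)"
      using preconditioned_pcg_dir[OF D B] by blast
  qed
  finally show ?thesis using v by blast
qed

section \<open>Convergence of the reduced basis method\<close>

lemma spd_shifted:
  assumes "spd_operator A" "t \<ge> 0"
  shows "spd_operator (shifted A t)"
proof -
  interpret A: spd_operator A by fact
  show ?thesis
  proof (rule spd_operator.intro)
    show "linear (shifted A t)"
      by (rule linearI) (simp_all add: shifted_def A.C_simps algebra_simps)
    show "shifted A t v \<bullet> w = shifted A t w \<bullet> v" for v w
      using A.sym[of v w] by (simp add: shifted_def inner_add_left inner_commute[of v w])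
    show "shifted A t v \<bullet> v > 0" if "v \<noteq> 0" for v
      using A.pos[OF that] assms(2) by (simp add: shifted_def inner_add_left add_pos_nonneg)
  qed
qed

lemma energy_norm_shifted_mono:
  assumes "t \<ge> 0"
  shows "energy_norm A v \<le> energy_norm (shifted A t) v"
  using assms by (simp add: energy_norm_def shifted_def inner_add_left)

text \<open>
  The search directions belong to the shift \<open>d\<close>, the Galerkin problem to the shift \<open>t\<close>. What
  links them is \<open>B A\<^sub>r = I + (r - s) B\<close> for \<open>r = d\<close> and \<open>r = t\<close>: for \<open>r = d\<close> it is solved for
  \<open>B\<close>, which needs \<open>s \<noteq> d\<close>.
\<close>

lemma galerkin_pcg_space_error:
  assumes A: "spd_operator A" and s: "s \<ge> 0" and d: "d \<ge> 0" and t: "t \<ge> 0" and sd: "s \<noteq> d"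
    and m: "m \<ge> 1"
  defines "B \<equiv> inv (shifted A s)" and "C \<equiv> shifted A t"
  defines "\<kappa> \<equiv> spectral_cond (B \<circ> C)"
  shows "energy_norm C (inv C f - galerkin A (pcg_space (shifted A d) B f m) f t)
    \<le> 2 * ((sqrt \<kappa> - 1) / (sqrt \<kappa> + 1)) ^ m * energy_norm C (inv C f)"
proof -
  interpret S: spd_operator "shifted A s" using spd_shifted[OF A s] .
  interpret C: spd_operator C unfolding C_def using spd_shifted[OF A t] .
  interpret B: spd_operator B unfolding B_def by (rule S.spd_inv)
  have D: "spd_operator (shifted A d)" by (rule spd_shifted[OF A d])
  let ?T = "B \<circ> C"
  define V where "V = pcg_space (shifted A d) B f"
  have B_shifted: "B (shifted A r v) = v + (r - s) *\<^sub>R B v" for r v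
  proof -
    have "shifted A r v = shifted A s v + (r - s) *\<^sub>R v"
      by (simp add: shifted_def algebra_simps)
    moreover have "B (shifted A s v) = v"
      unfolding B_def using S.injective by simp
    ultimately show ?thesis by (simp add: B.C_simps)
  qed
  have V: "subspace (V k)" and mono: "V k \<subseteq> V (Suc k)" for k
    unfolding V_def by (rule subspace_pcg_space, rule pcg_space_Suc)
  have B_V: "B v \<in> V (Suc k)" if "v \<in> V k" for v k
  proof -
    have "B (shifted A d v) - v \<in> V (Suc k)"
      using that mono[of k] preconditioned_pcg_space[OF D B.spd_operator_axioms, of v f k]
      by (intro subspace_diff[OF V]) (auto simp: V_def)
    moreover have "B v = (1 / (d - s)) *\<^sub>R (B (shifted A d v) - v)"
      using sd by (simp add: B_shifted)
    ultimately show ?thesis using subspace_scale[OF V] by metis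
  qed
  have T_V: "?T v \<in> V (Suc k)" if "v \<in> V k" for v k
    unfolding o_def C_def B_shifted using B_V[OF that] that mono[of k]
    by (intro subspace_add[OF V] subspace_scale[OF V]) auto
  have "pcg_dir (shifted A d) B f 0 \<in> V 1"
    unfolding V_def by (rule pcg_dir_in_pcg_space) simp
  then have Tu: "?T (inv C f) \<in> V 1"
    by (simp add: pcg_dir_def C.apply_inv)
  have T: "C.self_adjoint ?T"
    unfolding C.self_adjoint_def
  proof (intro conjI allI)
    show "linear ?T" by (rule linear_compose[OF C.lin B.lin])
    show "C (?T v) \<bullet> w = C (?T w) \<bullet> v" for v w
      using C.sym[of "B (C v)" w] B.sym[of "C v" "C w"] C.sym[of v "B (C w)"]
      by (simp add: inner_commute)
  qed
  have pos: "l > 0" if "l \<in> eigenvalues ?T" for l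
  proof -
    from that obtain v where v: "v \<noteq> 0" "B (C v) = l *\<^sub>R v" by (auto simp: eigenvalues_def)
    then have "C v \<noteq> 0" using C.eq_0_iff[of v] by auto
    from B.pos[OF this] have "l * (C v \<bullet> v) > 0" by (simp add: v(2) inner_commute)
    then show ?thesis using C.pos[OF v(1)] by (simp add: zero_less_mult_iff)
  qed
  obtain w where w: "w \<in> V m"
      "energy_norm C (inv C f - w)
        \<le> 2 * ((sqrt \<kappa> - 1) / (sqrt \<kappa> + 1)) ^ m * energy_norm C (inv C f)"
    using C.krylov_chebyshev_approximation[of ?T V, OF T pos V mono T_V Tu m]
    unfolding \<kappa>_def by (rule bexE)
  have "energy_norm C (inv C f - galerkin A (V m) f t) \<le> energy_norm C (inv C f - w)"
    by (rule C.galerkin_best_approximation[OF C_def[THEN meta_eq_to_obj_eq] V w(1)])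
  with w(2) show ?thesis by (simp add: V_def)
qed

theorem theorem3p4:
  fixes A B :: "'a::euclidean_space \<Rightarrow> 'a" and f :: 'a
    and c t :: "nat \<Rightarrow> real" and a\<^sub>0 s d :: real and n m :: nat
  assumes "linear A"
    and "\<And>v w. A v \<bullet> w = A w \<bullet> v"
    and "a\<^sub>0 > 0"
    and "\<And>v. A v \<bullet> v \<ge> a\<^sub>0 * (v \<bullet> v)"
    and "n \<ge> 1" and "m \<ge> 1"
    and "\<And>i. i \<in> {1..n} \<Longrightarrow> t i > 0"
    and "s \<ge> 0" and "d \<ge> 0" and "s \<noteq> d"
    and "s \<notin> t ` {1..n}"
    and "B = inv (shifted A s)"
  shows "energy_norm A ((\<Sum>i=1..n. c i *\<^sub>R inv (shifted A (t i)) f) - rcgbm A f n c t B d m)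
    \<le> 2 * (\<Sum>i=1..n. \<bar>c i\<bar>
        * ((sqrt (spectral_cond (B \<circ> shifted A (t i))) - 1)
           / (sqrt (spectral_cond (B \<circ> shifted A (t i))) + 1)) ^ m
        * energy_norm (shifted A (t i)) (inv (shifted A (t i)) f))"
proof -
  have spd: "spd_operator A"
  proof (rule spd_operator.intro)
    show "A v \<bullet> v > 0" if "v \<noteq> 0" for v
      using assms(4)[of v] mult_pos_pos[OF assms(3), of "v \<bullet> v"] that by simp
  qed (fact assms(1), fact assms(2))
  interpret spd_operator A by fact
  define V where "V = pcg_space (shifted A d) B f m"
  define e where "e i = inv (shifted A (t i)) f - galerkin A V f (t i)" for i
  define \<rho> where "\<rho> i = (sqrt (spectral_cond (B \<circ> shifted A (t i))) - 1)
           / (sqrt (spectral_cond (B \<circ> shifted A (t i))) + 1)" for i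
  have "rcgbm A f n c t B d m = (\<Sum>i=1..n. c i *\<^sub>R galerkin A V f (t i))"
    by (simp add: rcgbm_def V_def pcg_space_def)
  then have "(\<Sum>i=1..n. c i *\<^sub>R inv (shifted A (t i)) f) - rcgbm A f n c t B d m
      = (\<Sum>i=1..n. c i *\<^sub>R e i)"
    by (simp add: e_def scaleR_diff_right sum_subtractf)
  then have "energy_norm A ((\<Sum>i=1..n. c i *\<^sub>R inv (shifted A (t i)) f) - rcgbm A f n c t B d m)
      \<le> (\<Sum>i=1..n. \<bar>c i\<bar> * energy_norm A (e i))"
    using energy_norm_sum[of "\<lambda>i. c i *\<^sub>R e i" "{1..n}"] by (simp add: energy_norm_scaleR)
  also have "\<dots> \<le> (\<Sum>i=1..n. \<bar>c i\<bar>
      * (2 * \<rho> i ^ m * energy_norm (shifted A (t i)) (inv (shifted A (t i)) f)))"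
  proof (intro sum_mono mult_left_mono)
    fix i assume i: "i \<in> {1..n}"
    then have t: "t i \<ge> 0" using assms(7) less_imp_le by blast
    have "energy_norm A (e i) \<le> energy_norm (shifted A (t i)) (e i)"
      by (rule energy_norm_shifted_mono[OF t])
    also have "\<dots> \<le> 2 * \<rho> i ^ m * energy_norm (shifted A (t i)) (inv (shifted A (t i)) f)"
      using galerkin_pcg_space_error[OF spd assms(8,9) t assms(10,6), of f]
      unfolding e_def \<rho>_def V_def assms(12) .
    finally show "energy_norm A (e i)
      \<le> 2 * \<rho> i ^ m * energy_norm (shifted A (t i)) (inv (shifted A (t i)) f)" .
  qed simp
  also have "\<dots> = 2 * (\<Sum>i=1..n. \<bar>c i\<bar> * \<rho> i ^ m
      * energy_norm (shifted A (t i)) (inv (shifted A (t i)) f))"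
    by (simp add: sum_distrib_left mult_ac)
  finally show ?thesis by (simp add: \<rho>_def)
qed

end
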